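(* Let $V$ be a Novikov algebra over $\Bbbk$ with operation $(x,y)\mapsto x\circ y$, and let $a(z),b(z),c(z)\in V[[z,z^{-1}]]$ be pairwise mutually local formal distributions over $V$. Then for every $n\in\mathbb Z_+$ the formal distributions $a(z)$, $(b\,{}_{(n)}\,c)(z)$ form a local pair $(a(z),\,(b\,{}_{(n)}\,c)(z))$ in $V[[z,z^{-1}]]$.
   Context: $\Bbbk$ is a field of characteristic zero and $\mathbb Z_+$ is the set of non-negative integers. A Novikov algebra is a $\Bbbk$-linear space $V$ with a bilinear operation $\circ$ such that for all $x,y,z\in V$ $$(x\circ y)\circ z-x\circ(y\circ z)=(x\circ z)\circ y-x\circ(z\circ y),\qquad x\circ(y\circ z)=y\circ(x\circ z).$$ A formal distribution over $V$ is a two-sided infinite formal series $a(z)=\sum_{n\in\mathbb Z}a_nz^{-n-1}$ with $a_n\in V$; the space of these is $V[[z,z^{-1}]]$. For formal distributions $a(z),b(z)$ put $a(w)\circ b(z)=\sum_{n,m\in\mathbb Z}(a_n\circ b_m)w^{-n-1}z^{-m-1}\in V[[w,w^{-1},z,z^{-1}]]$. The ordered pair $(a(z),b(z))$ is local if there is $N\in\mathbb Z_+$ with $(a(w)\circ b(z))(w-z)^N=0$. The distributions $a(z),b(z)$ are mutually local if both $(a(z),b(z))$ and $(b(z),a(z))$ are local pairs; "pairwise mutually local" means each two of the given distributions are mutually local. For $n\in\mathbb Z_+$, the $n$-product is $(a\,{}_{(n)}\,b)(z)=\mathrm{Res}_{w=0}\,(a(w)\circ b(z))(w-z)^n$, where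 $\mathrm{Res}_{w=0}$ is the coefficient at $w^{-1}$; explicitly, its coefficient of $z^{-m-1}$ is $\sum_{s\ge 0}(-1)^s\binom ns a_{n-s}\circ b_{m+s}$. *)

theory Defs
  imports Complex_Main
begin

locale novikov_algebra = vector_space scale
  for scale :: "'k::field_char_0 \<Rightarrow> 'v::ab_group_add \<Rightarrow> 'v" +
  fixes mul :: "'v \<Rightarrow> 'v \<Rightarrow> 'v"  (infixl "\<diamondop>" 70)
  assumes linear_left: "\<And>y. Vector_Spaces.linear scale scale (\<lambda>x. x \<diamondop> y)"
    and linear_right: "\<And>x. Vector_Spaces.linear scale scale (\<lambda>y. x \<diamondop> y)"
    and right_symmetric:
      "\<And>x y z. (x \<diamondop> y) \<diamondop> z - x \<diamondop> (y \<diamondop> z) = (x \<diamondop> z) \<diamondop> y - x \<diamondop> (z \<diamondop> y)"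
    and left_commutative: "\<And>x y z. x \<diamondop> (y \<diamondop> z) = y \<diamondop> (x \<diamondop> z)"

text \<open>
  The function \<open>a\<close> encodes the series whose coefficient at \<open>z\<close> to the power \<open>- n - 1\<close> is \<open>a n\<close>;
  likewise \<open>F n m\<close> is the coefficient at \<open>w\<close> to the power \<open>- n - 1\<close> times \<open>z\<close> to the power
  \<open>- m - 1\<close>.
\<close>

type_synonym 'v fdist = "int \<Rightarrow> 'v"
type_synonym 'v fdist2 = "int \<Rightarrow> int \<Rightarrow> 'v"

definition fdist_mul :: "('v \<Rightarrow> 'v \<Rightarrow> 'v) \<Rightarrow> 'v fdist \<Rightarrow> 'v fdist \<Rightarrow> 'v fdist2" where
  "fdist_mul mul a b = (\<lambda>n m. mul (a n) (b m))"

text \<open>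
  Multiplication by \<open>w - z\<close>: multiplying by \<open>w\<close> moves the coefficient with index \<open>n + 1\<close> to
  index \<open>n\<close>. Multiplication by a power of \<open>w - z\<close> is the iterate.
\<close>

definition times_wz :: "'v::ab_group_add fdist2 \<Rightarrow> 'v fdist2" where
  "times_wz F = (\<lambda>n m. F (n + 1) m - F n (m + 1))"

text \<open>The exponent \<open>- 1\<close> of \<open>w\<close> belongs to the index \<open>0\<close>.\<close>

definition res_w :: "'v fdist2 \<Rightarrow> 'v fdist" where
  "res_w F = (\<lambda>m. F 0 m)"

definition local_pair :: "('v::ab_group_add \<Rightarrow> 'v \<Rightarrow> 'v) \<Rightarrow> 'v fdist \<Rightarrow> 'v fdist \<Rightarrow> bool" where
  "local_pair mul a b \<longleftrightarrow> (\<exists>N. (times_wz ^^ N) (fdist_mul mul a b) = (\<lambda>n m. 0))"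

definition mutually_local :: "('v::ab_group_add \<Rightarrow> 'v \<Rightarrow> 'v) \<Rightarrow> 'v fdist \<Rightarrow> 'v fdist \<Rightarrow> bool" where
  "mutually_local mul a b \<longleftrightarrow> local_pair mul a b \<and> local_pair mul b a"

definition n_product ::
  "('v::ab_group_add \<Rightarrow> 'v \<Rightarrow> 'v) \<Rightarrow> nat \<Rightarrow> 'v fdist \<Rightarrow> 'v fdist \<Rightarrow> 'v fdist" where
  "n_product mul n a b = res_w ((times_wz ^^ n) (fdist_mul mul a b))"

lemma (in vector_space) times_wz_power:
  "(times_wz ^^ N) F n m =
     (\<Sum>s\<le>N. scale ((- 1) ^ s * of_nat (N choose s)) (F (n + int N - int s) (m + int s)))"
proof (induction N arbitrary: n m)
  case 0
  then show ?case by simp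
next
  case (Suc N)
  define G where "G s = F (n + 1 + int N - int s) (m + int s)" for s
  have 1: "(times_wz ^^ N) F (n + 1) m
      = (\<Sum>s\<le>Suc N. scale ((- 1) ^ s * of_nat (N choose s)) (G s))"
    unfolding Suc.IH G_def by (simp add: binomial_eq_0)
  have "(times_wz ^^ N) F n (m + 1)
      = (\<Sum>s\<le>N. scale ((- 1) ^ s * of_nat (N choose s)) (G (Suc s)))"
    unfolding Suc.IH G_def by (simp add: algebra_simps)
  also have "\<dots> = - (\<Sum>s\<le>N. scale ((- 1) ^ Suc s * of_nat (N choose s)) (G (Suc s)))"
    by (simp add: sum_negf)
  finally have 2: "(times_wz ^^ N) F n (m + 1)
      = - (\<Sum>s\<le>N. scale ((- 1) ^ Suc s * of_nat (N choose s)) (G (Suc s)))" .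
  have "(times_wz ^^ Suc N) F n m
      = (\<Sum>s\<le>Suc N. scale ((- 1) ^ s * of_nat (N choose s)) (G s))
        + (\<Sum>s\<le>N. scale ((- 1) ^ Suc s * of_nat (N choose s)) (G (Suc s)))"
    using 1 2 by (simp add: times_wz_def)
  also have "\<dots> = (\<Sum>s\<le>Suc N. scale ((- 1) ^ s * of_nat (Suc N choose s)) (G s))"
    unfolding sum.atMost_Suc_shift
    by (simp add: scale_left_distrib scale_left_diff_distrib sum.distrib sum_subtractf
        sum_negf algebra_simps)
  finally show ?case by (simp add: G_def algebra_simps)
qed

lemma (in vector_space) n_product_coeff:
  "n_product mul n a b m =
     (\<Sum>s\<le>n. scale ((- 1) ^ s * of_nat (n choose s)) (mul (a (int n - int s)) (b (m + int s))))"
  by (simp add: n_product_def res_w_def times_wz_power fdist_mul_def)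

end

theory Submission
  imports Defs
begin

text \<open>
  The \<open>n\<close>-product inherits locality from \<open>c\<close>. By left commutativity the distribution
  \<open>a(x) \<circ> (b(w) \<circ> c(z))\<close> in three variables equals \<open>b(w) \<circ> (a(x) \<circ> c(z))\<close>. Multiplication by
  \<open>x - z\<close> passes through the left multiplications by the coefficients of \<open>b(w)\<close>, so a power
  \<open>(x - z) ^ N\<close> that annihilates \<open>a(x) \<circ> c(z)\<close> annihilates all of it. The residue at \<open>w = 0\<close>
  after multiplication by \<open>(w - z) ^ n\<close> commutes with multiplication by \<open>x - z\<close>, so the same
  exponent \<open>N\<close> works for \<open>a(x)\<close> and the \<open>n\<close>-product of \<open>b\<close> and \<open>c\<close>.

  In coefficients, \<open>a\<close> times the \<open>n\<close>-product is a finite sum of images of \<open>a(x) \<circ> c(z)\<close> under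
  additive maps, each combined with a shift of the index of \<open>z\<close>
  (\<open>mul_n_product_coeff\<close>); and such operators commute with multiplication by \<open>(x - z) ^ N\<close>
  (\<open>times_wz_power_sum_shift\<close>).
\<close>

text \<open>
  Applying an additive map to every coefficient, and multiplying by a power of the second
  variable, both commute with multiplication by \<open>w - z\<close>.
\<close>

lemma times_wz_power_sum_shift:
  fixes F :: "'v::ab_group_add fdist2" and h :: "'i \<Rightarrow> 'v \<Rightarrow> 'u::ab_group_add"
  assumes diff: "\<And>i x y. i \<in> I \<Longrightarrow> h i (x - y) = h i x - h i y"
  shows "(times_wz ^^ N) (\<lambda>p m. \<Sum>i\<in>I. h i (F p (m + d i)))
       = (\<lambda>p m. \<Sum>i\<in>I. h i ((times_wz ^^ N) F p (m + d i)))"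
proof (induction N)
  case 0
  then show ?case by simp
next
  case (Suc N)
  then show ?case
    by (simp add: times_wz_def diff sum_subtractf[symmetric] add.commute add.left_commute
        cong: sum.cong)
qed

context novikov_algebra
begin

text \<open>
  Left commutativity moves \<open>a p\<close> past the coefficients of \<open>b\<close>, so that the locality of \<open>a\<close>
  and \<open>c\<close> becomes applicable to the inner product.
\<close>

lemma mul_n_product_coeff:
  "a p \<diamondop> n_product (\<diamondop>) n b c m =
     (\<Sum>s\<le>n. scale ((- 1) ^ s * of_nat (n choose s))
               (b (int n - int s) \<diamondop> (a p \<diamondop> c (m + int s))))"
proof -
  interpret right: Vector_Spaces.linear scale scale "\<lambda>y. a p \<diamondop> y"
    by (rule linear_right)
  show ?thesis
    unfolding n_product_coeff right.sum right.scale
    by (simp only: left_commutative[of "a p"])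
qed

lemma local_pair_n_product:
  assumes "local_pair (\<diamondop>) a c"
  shows "local_pair (\<diamondop>) a (n_product (\<diamondop>) n b c)"
proof -
  obtain N where N: "(times_wz ^^ N) (fdist_mul (\<diamondop>) a c) = (\<lambda>n m. 0)"
    using assms by (auto simp: local_pair_def)
  define h where
    "h s y = scale ((- 1) ^ s * of_nat (n choose s)) (b (int n - int s) \<diamondop> y)" for s y
  have h_diff: "h s (x - y) = h s x - h s y" for s x y
  proof -
    interpret right: Vector_Spaces.linear scale scale "\<lambda>y. b (int n - int s) \<diamondop> y"
      by (rule linear_right)
    show ?thesis
      by (simp add: h_def right.diff scale_right_diff_distrib)
  qed
  have h_0: "h s 0 = 0" for s
    using h_diff[of s 0 0] by simp
  have "fdist_mul (\<diamondop>) a (n_product (\<diamondop>) n b c)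
      = (\<lambda>p m. \<Sum>s\<le>n. h s (fdist_mul (\<diamondop>) a c p (m + int s)))"
    by (simp add: fdist_mul_def mul_n_product_coeff h_def)
  then have "(times_wz ^^ N) (fdist_mul (\<diamondop>) a (n_product (\<diamondop>) n b c)) = (\<lambda>p m. 0)"
    by (simp add: times_wz_power_sum_shift h_diff N h_0)
  then show ?thesis
    unfolding local_pair_def ..
qed

end

theorem corollary1:
  fixes scale :: "'k::field_char_0 \<Rightarrow> 'v::ab_group_add \<Rightarrow> 'v"
    and mul :: "'v \<Rightarrow> 'v \<Rightarrow> 'v"
    and a b c :: "'v fdist"
    and n :: nat
  assumes "novikov_algebra scale mul"
    and "mutually_local mul a b"
    and "mutually_local mul a c"
    and "mutually_local mul b c"
  shows "local_pair mul a (n_product mul n b c)"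
  using novikov_algebra.local_pair_n_product[OF assms(1)] assms(3)
  by (simp add: mutually_local_def)

end
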